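(* In the "all violated constraints" model, hidden 2SAT can be solved in polynomial time: there is an algorithm which, given oracle access to a hidden 2SAT instance on $n$ variables and $m$ clauses, finds a satisfying assignment if one exists, and otherwise determines that the instance is unsatisfiable, in time polynomial in $n$ and $m$.
   Context: A SAT formula on Boolean variables $x_1,\dots,x_n$ is a conjunction of clauses $C_1,\dots,C_m$; each clause is a disjunction of literals ($x_i$ or $\overline{x}_i$) on pairwise distinct variables. It is a 2SAT instance if every clause has at most $2$ literals. Clauses with the same set of literals may occur several times. "All violated constraints" model: the formula is hidden, and the algorithm accesses it only through an oracle. A query is an assignment $\mathbf{x}\in\{0,1\}^n$, and the oracle returns the set of indices $j\in[m]$ of all clauses $C_j$ violated (evaluated to $0$) by $\mathbf{x}$; in particular, if this set is empty then $\mathbf{x}$ is a satisfying assignment. Running time is total running time, with each oracle query costing unit time. *)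

theory Defs
  imports "HOL-Computational_Algebra.Polynomial"
begin

section \<open>Hidden SAT formulas\<close>

datatype lit = Pos (var: nat) | Neg (var: nat)

text \<open>
  Variables are numbered from \<open>0\<close>. An assignment is a function on all natural numbers; for a
  formula on \<open>n\<close> variables only its values below \<open>n\<close> matter.
\<close>

type_synonym assignment = "nat \<Rightarrow> bool"
type_synonym clause = "lit set"
type_synonym formula = "clause list"

fun lit_true :: "assignment \<Rightarrow> lit \<Rightarrow> bool" where
  "lit_true x (Pos i) \<longleftrightarrow> x i"
| "lit_true x (Neg i) \<longleftrightarrow> \<not> x i"

definition clause_true :: "assignment \<Rightarrow> clause \<Rightarrow> bool" where
  "clause_true x C \<longleftrightarrow> (\<exists>l\<in>C. lit_true x l)"

definition satisfies :: "assignment \<Rightarrow> formula \<Rightarrow> bool" where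
  "satisfies x \<phi> \<longleftrightarrow> (\<forall>C\<in>set \<phi>. clause_true x C)"

definition satisfiable :: "formula \<Rightarrow> bool" where
  "satisfiable \<phi> \<longleftrightarrow> (\<exists>x. satisfies x \<phi>)"

definition sat_instance :: "nat \<Rightarrow> formula \<Rightarrow> bool" where
  "sat_instance n \<phi> \<longleftrightarrow> (\<forall>C\<in>set \<phi>. finite C \<and> inj_on var C \<and> var ` C \<subseteq> {..<n})"

text \<open>The empty clause is allowed; it is violated by every assignment.\<close>

definition two_sat_instance :: "nat \<Rightarrow> formula \<Rightarrow> bool" where
  "two_sat_instance n \<phi> \<longleftrightarrow> sat_instance n \<phi> \<and> (\<forall>C\<in>set \<phi>. card C \<le> 2)"

definition violated :: "formula \<Rightarrow> assignment \<Rightarrow> nat set" where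
  "violated \<phi> x = {j. j < length \<phi> \<and> \<not> clause_true x (\<phi> ! j)}"

section \<open>Algorithms querying oracles\<close>

text \<open>
  Algorithms are programs of a deterministic random access machine. A program uses finitely many
  registers and arrays, all holding natural numbers; array elements are accessed by computed
  indices. Every operation takes one time unit. The only arithmetic is addition and truncated
  subtraction, so within time \<open>t\<close> the bit length of all numbers grows by at most \<open>O(t)\<close>, and
  running times agree with those of Turing machines up to a polynomial. (With multiplication at
  unit cost, this would fail.)
\<close>

record state =
  reg :: "string \<Rightarrow> nat"
  arr :: "string \<Rightarrow> nat \<Rightarrow> nat"

datatype exp =
    Num nat
  | Reg string
  | Elem string exp
  | Add exp exp
  | Sub exp exp

fun val :: "exp \<Rightarrow> state \<Rightarrow> nat" where
  "val (Num k) s = k"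
| "val (Reg r) s = reg s r"
| "val (Elem a e) s = arr s a (val e s)"
| "val (Add e f) s = val e s + val f s"
| "val (Sub e f) s = val e s - val f s"

fun cost :: "exp \<Rightarrow> nat" where
  "cost (Num k) = 1"
| "cost (Reg r) = 1"
| "cost (Elem a e) = 1 + cost e"
| "cost (Add e f) = 1 + cost e + cost f"
| "cost (Sub e f) = 1 + cost e + cost f"

datatype com =
    Skip
  | Assign string exp
  | Store string exp exp
  | Query string string
  | Seq com com
  | Cond exp com com
  | While exp com

type_synonym clause_oracle = "assignment \<Rightarrow> nat set"

text \<open>
  \<open>exec \<O> c s t s'\<close>: with queries answered by \<open>\<O>\<close>, the program \<open>c\<close> started in state \<open>s\<close> halts in state \<open>s'\<close>
  after exactly \<open>t\<close> time units. Conditions hold if their value is nonzero. \<open>Query a b\<close> submits the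
  assignment stored in array \<open>a\<close> (nonzero elements meaning true) and overwrites array \<open>b\<close> with the
  characteristic function of the returned set.
\<close>

inductive exec :: "clause_oracle \<Rightarrow> com \<Rightarrow> state \<Rightarrow> nat \<Rightarrow> state \<Rightarrow> bool" for \<O> :: clause_oracle where
  Skip: "exec \<O> Skip s 1 s"
| Assign: "exec \<O> (Assign r e) s (1 + cost e) (s\<lparr>reg := (reg s)(r := val e s)\<rparr>)"
| Store: "exec \<O> (Store a i e) s (1 + cost i + cost e)
    (s\<lparr>arr := (arr s)(a := (arr s a)(val i s := val e s))\<rparr>)"
| Query: "exec \<O> (Query a b) s 1
    (s\<lparr>arr := (arr s)(b := (\<lambda>j. if j \<in> \<O> (\<lambda>i. arr s a i \<noteq> 0) then 1 else 0))\<rparr>)"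
| Seq: "exec \<O> c s t s' \<Longrightarrow> exec \<O> d s' u s'' \<Longrightarrow> exec \<O> (Seq c d) s (t + u) s''"
| CondTrue: "val e s \<noteq> 0 \<Longrightarrow> exec \<O> c s t s' \<Longrightarrow> exec \<O> (Cond e c d) s (1 + cost e + t) s'"
| CondFalse: "val e s = 0 \<Longrightarrow> exec \<O> d s t s' \<Longrightarrow> exec \<O> (Cond e c d) s (1 + cost e + t) s'"
| WhileFalse: "val e s = 0 \<Longrightarrow> exec \<O> (While e c) s (1 + cost e) s"
| WhileTrue: "val e s \<noteq> 0 \<Longrightarrow> exec \<O> c s t s' \<Longrightarrow> exec \<O> (While e c) s' u s'' \<Longrightarrow>
    exec \<O> (While e c) s (1 + cost e + t + u) s''"

inductive_cases exec_elims:
  "exec \<O> Skip s t s'"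
  "exec \<O> (Assign r e) s t s'"
  "exec \<O> (Store a i e) s t s'"
  "exec \<O> (Query a b) s t s'"
  "exec \<O> (Seq c d) s t s'"
  "exec \<O> (Cond e c d) s t s'"
inductive_cases exec_WhileE: "exec \<O> (While e c) s t s'"

lemma exec_deterministic:
  "exec \<O> c s t s' \<Longrightarrow> exec \<O> c s u s'' \<Longrightarrow> t = u \<and> s' = s''"
proof (induction arbitrary: u s'' rule: exec.induct)
  case (Seq c s t s' d v s1)
  from Seq.prems obtain t' v' s2 where
    "exec \<O> c s t' s2" "exec \<O> d s2 v' s''" "u = t' + v'"
    by (rule exec_elims)
  with Seq.IH show ?case by blast
next
  case (CondTrue e s c t s' d)
  from CondTrue.prems CondTrue.hyps(1) obtain t' where "exec \<O> c s t' s''" "u = 1 + cost e + t'"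
    by (auto elim: exec_elims)
  with CondTrue.IH show ?case by blast
next
  case (CondFalse e s d t s' c)
  from CondFalse.prems CondFalse.hyps(1) obtain t' where "exec \<O> d s t' s''" "u = 1 + cost e + t'"
    by (auto elim: exec_elims)
  with CondFalse.IH show ?case by blast
next
  case (WhileTrue e s c t s' v s1)
  from WhileTrue.prems WhileTrue.hyps(1) obtain t' v' s2 where
    "exec \<O> c s t' s2" "exec \<O> (While e c) s2 v' s''" "u = 1 + cost e + t' + v'"
    by (auto elim: exec_WhileE)
  with WhileTrue.IH show ?case by blast
qed (auto elim: exec_elims exec_WhileE)

text \<open>The program receives \<open>n\<close> and \<open>m\<close> in two registers; everything else is initially zero.\<close>

definition initial :: "nat \<Rightarrow> nat \<Rightarrow> state" where
  "initial n m = \<lparr>reg = (\<lambda>_. 0)(''n'' := n, ''m'' := m), arr = (\<lambda>_ _. 0)\<rparr>"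

text \<open>
  The answer is read from register \<open>sat\<close> (\<open>1\<close> for satisfiable, \<open>0\<close> for unsatisfiable) and, in the
  first case, from array \<open>x\<close>, which must hold a satisfying assignment.
\<close>

definition correct_output :: "formula \<Rightarrow> state \<Rightarrow> bool" where
  "correct_output \<phi> s \<longleftrightarrow>
    (if satisfiable \<phi> then reg s ''sat'' = 1 \<and> satisfies (\<lambda>i. arr s ''x'' i \<noteq> 0) \<phi>
     else reg s ''sat'' = 0)"

text \<open>Evaluation of a polynomial in two variables.\<close>

definition poly2 :: "nat poly poly \<Rightarrow> nat \<Rightarrow> nat \<Rightarrow> nat" where
  "poly2 p n m = poly (poly p [:n:]) m"

end

theory Submission
  imports Defs
begin

text \<open>
  A partial assignment is a box \<open>{l..h}\<close> of assignments. A clause violated by both \<open>l\<close> and \<open>h\<close> is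
  violated throughout the box, so two queries detect whether a partial assignment falsifies some
  clause, and unit propagation can be performed without learning the clauses: a value of a free
  variable is forced if the opposite value produces such a conflict. The variables are fixed one
  after the other. Variable \<open>i\<close> is tentatively set to true; if propagation runs into a conflict, it
  has to be false. Otherwise, as clauses have at most two literals, every clause touched by the
  propagated box is satisfied by it, so any satisfying assignment can be moved into the box.
  A final query decides whether the resulting assignment is satisfying.
\<close>

section \<open>Unit propagation by conflict tests\<close>

type_synonym box = "assignment \<times> assignment"

definition conflict :: "clause_oracle \<Rightarrow> box \<Rightarrow> bool" where
  "conflict \<O> p \<longleftrightarrow> \<O> (fst p) \<inter> \<O> (snd p) \<noteq> {}"

text \<open>If both values conflict, the first test wins and yields
  \<open>(l(v := True), h)\<close>. This box is itself in conflict, so the failure stays visible to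
  a later test.\<close>

definition force :: "clause_oracle \<Rightarrow> nat \<Rightarrow> box \<Rightarrow> box" where
  "force \<O> v p = (let (l, h) = p in
     if l v \<or> \<not> h v then p
     else if conflict \<O> (l, h(v := False)) then (l(v := True), h)
     else if conflict \<O> (l(v := True), h) then (l, h(v := False))
     else p)"

text \<open>\<open>n\<close> sweeps reach a fixed point, since every sweep before it fixes at least
  one of at most \<open>n\<close> free variables.\<close>

definition propagate :: "clause_oracle \<Rightarrow> nat \<Rightarrow> box \<Rightarrow> box" where
  "propagate \<O> n = fold (force \<O>) [0..<n] ^^ n"

text \<open>The propagated box serves only as a test and is then discarded. Thus each call fixes
  variable \<open>i\<close> alone, and the fixed variables are always an initial segment.\<close>

definition decide :: "clause_oracle \<Rightarrow> nat \<Rightarrow> nat \<Rightarrow> box \<Rightarrow> box" where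
  "decide \<O> n i p = (let (l, h) = p in
     if conflict \<O> (propagate \<O> n (l(i := True), h)) then (l, h(i := False)) else (l(i := True), h))"

text \<open>Refinement of boxes. On the diagonal, \<open>box_in n p p\<close> is well-formedness:
  \<open>p\<close> is nonempty and constantly false from variable \<open>n\<close> on.\<close>

definition box_in :: "nat \<Rightarrow> box \<Rightarrow> box \<Rightarrow> bool" where
  "box_in n p q \<longleftrightarrow> fst p \<le> fst q \<and> fst q \<le> snd q \<and> snd q \<le> snd p \<and> (\<forall>v\<ge>n. \<not> snd p v)"

definition free_vars :: "box \<Rightarrow> nat set" where
  "free_vars p = {v. \<not> fst p v \<and> snd p v}"

lemma box_in_trans: "box_in n p q \<Longrightarrow> box_in n q r \<Longrightarrow> box_in n p r"
  unfolding box_in_def by (meson order_trans)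

lemma box_in_refl: "box_in n p q \<Longrightarrow> box_in n q q"
  unfolding box_in_def by (auto simp: le_fun_def)

lemma free_vars_subset: "box_in n p p \<Longrightarrow> free_vars p \<subseteq> {..<n}"
  unfolding box_in_def free_vars_def by (auto simp: not_le[symmetric])

lemma force_box_in: "box_in n p p \<Longrightarrow> box_in n p (force \<O> v p)"
  unfolding box_in_def force_def by (auto simp: le_fun_def split: prod.splits)

lemma force_free_vars:
  "force \<O> v p = p \<or> free_vars (force \<O> v p) \<subset> free_vars p"
  unfolding force_def free_vars_def by (auto split: prod.splits)

lemma fold_force_box_in: "box_in n p p \<Longrightarrow> box_in n p (fold (force \<O>) vs p)"
proof (induction vs arbitrary: p)
  case (Cons v vs)
  have "box_in n p (force \<O> v p)" by (rule force_box_in[OF Cons.prems])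
  with Cons.IH[OF box_in_refl[OF this]] show ?case by (auto intro: box_in_trans)
qed simp

text \<open>Until some \<open>force\<close> step changes the box, the sweep still works on
  \<open>p\<close>; the first change fixes a free variable, and no later step frees one.\<close>

lemma fold_force_free_vars:
  "if \<forall>v\<in>set vs. force \<O> v p = p then fold (force \<O>) vs p = p
   else free_vars (fold (force \<O>) vs p) \<subset> free_vars p"
proof (induction vs arbitrary: p)
  case (Cons v vs)
  show ?case
    using Cons.IH[of "force \<O> v p"] force_free_vars[of \<O> v p] by (auto split: if_splits)
qed simp

lemma propagate_box_in:
  assumes "box_in n p p"
  shows "box_in n p (propagate \<O> n p)"
proof -
  have "box_in n p ((fold (force \<O>) [0..<n] ^^ k) p)" for k
    by (induction k) (use assms in \<open>auto intro: box_in_trans fold_force_box_in box_in_refl\<close>)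
  then show ?thesis unfolding propagate_def .
qed

text \<open>The number of free variables is the measure: a sweep either decreases it or has already
  reached a fixed point.\<close>

lemma propagate_closed:
  assumes p: "box_in n p p" and v: "v < n"
  shows "force \<O> v (propagate \<O> n p) = propagate \<O> n p"
proof -
  let ?q = "\<lambda>k. (fold (force \<O>) [0..<n] ^^ k) p"
  have fin: "free_vars (?q k) \<subseteq> {..<n}" for k
  proof -
    have "box_in n (?q k) (?q k)"
      by (induction k) (use p in \<open>auto intro: fold_force_box_in box_in_refl\<close>)
    then show ?thesis by (rule free_vars_subset)
  qed
  have "card (free_vars (?q k)) + k \<le> n \<or> (\<forall>v<n. force \<O> v (?q k) = ?q k)" for k
  proof (induction k)
    case 0
    show ?case using card_mono[OF _ fin[of 0]] by simp
  next
    case (Suc k)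
    have step: "if \<forall>v<n. force \<O> v (?q k) = ?q k then ?q (Suc k) = ?q k
      else free_vars (?q (Suc k)) \<subset> free_vars (?q k)"
      using fold_force_free_vars[where vs = "[0..<n]" and p = "?q k" and \<O> = \<O>] by (simp add: Ball_def)
    show ?case
    proof (cases "\<forall>v<n. force \<O> v (?q k) = ?q k")
      case True
      with step have "?q (Suc k) = ?q k" by (simp only: if_True)
      with True show ?thesis by (simp del: funpow.simps)
    next
      case False
      with step have "free_vars (?q (Suc k)) \<subset> free_vars (?q k)" by (simp only: if_False)
      then have "card (free_vars (?q (Suc k))) < card (free_vars (?q k))"
        using fin[of k] by (meson finite_lessThan finite_subset psubset_card_mono)
      moreover from False Suc.IH have "card (free_vars (?q k)) + k \<le> n" by blast
      ultimately have "card (free_vars (?q (Suc k))) + Suc k \<le> n" by linarith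
      then show ?thesis ..
    qed
  qed
  from this[of n] show ?thesis
  proof
    assume "card (free_vars (?q n)) + n \<le> n"
    \<comment> \<open>With nothing free, \<open>force\<close> takes its first branch for every
      variable.\<close>
    then have "free_vars (?q n) = {}"
      using fin[of n] finite_subset by fastforce
    then show ?thesis
      unfolding propagate_def force_def free_vars_def by (auto split: prod.splits)
  qed (use v in \<open>simp add: propagate_def\<close>)
qed

section \<open>Soundness of propagation and the two-literal property\<close>

abbreviation points :: "box \<Rightarrow> assignment set" where
  "points p \<equiv> {fst p..snd p}"

text \<open>A positive literal true at \<open>z\<close> is true at the upper end of the box, a
  negative one at the lower end.\<close>

lemma clause_false_in_box:
  assumes "\<not> clause_true (fst p) C" "\<not> clause_true (snd p) C" "z \<in> points p"
  shows "\<not> clause_true z C"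
proof -
  have "lit_true (fst p) l \<or> lit_true (snd p) l" if "lit_true z l" for l
    using that assms(3) by (cases l) (auto simp: le_fun_def)
  with assms(1,2) show ?thesis unfolding clause_true_def by blast
qed

lemma conflict_sound:
  assumes "conflict (violated \<phi>) p" "z \<in> points p"
  shows "\<not> satisfies z \<phi>"
  using assms clause_false_in_box nth_mem
  unfolding conflict_def violated_def satisfies_def by fast

lemma conflictI:
  assumes "C \<in> set \<phi>" "\<not> clause_true (fst p) C" "\<not> clause_true (snd p) C"
  shows "conflict (violated \<phi>) p"
  using assms unfolding conflict_def violated_def by (auto simp: in_set_conv_nth)

text \<open>A free variable splits the box into two halves. A half in conflict contains no
  satisfying assignment, so \<open>z\<close> lies in the half that is kept.\<close>

lemma force_sound:
  assumes z: "satisfies z \<phi>" "z \<in> points p"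
  shows "z \<in> points (force (violated \<phi>) v p)"
proof -
  obtain l h where p: "p = (l, h)" by fastforce
  have 1: "z v" if "conflict (violated \<phi>) (l, h(v := False))"
  proof (rule ccontr)
    assume "\<not> z v"
    with z p have "z \<in> points (l, h(v := False))" by (auto simp: le_fun_def)
    with conflict_sound[OF that] z show False by blast
  qed
  have 2: "\<not> z v" if "conflict (violated \<phi>) (l(v := True), h)"
  proof
    assume "z v"
    with z p have "z \<in> points (l(v := True), h)" by (auto simp: le_fun_def)
    with conflict_sound[OF that] z show False by blast
  qed
  show ?thesis
    using z 1 2 unfolding p force_def by (auto simp: le_fun_def)
qed

lemma propagate_sound:
  assumes "satisfies z \<phi>" "z \<in> points p"
  shows "z \<in> points (propagate (violated \<phi>) n p)"
proof -
  have fold: "z \<in> points (fold (force (violated \<phi>)) vs q)" if "z \<in> points q" for vs q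
    using that force_sound[OF assms(1)] by (induction vs arbitrary: q) auto
  have "z \<in> points ((fold (force (violated \<phi>)) [0..<n] ^^ k) p)" for k
  proof (induction k)
    case (Suc k)
    from fold[OF this] show ?case by simp
  qed (use assms(2) in simp)
  then show ?thesis unfolding propagate_def .
qed

text \<open>Here two literals per clause matter. Project \<open>z\<close> into the box. If this
  breaks a clause, the literal \<open>a\<close> that \<open>z\<close> made true is fixed to false,
  so at most one other literal remains. Fixed to false as well, it would give a conflict; free, it
  would have been forced.\<close>

lemma closed_extends:
  assumes two: "two_sat_instance n \<phi>" and p: "box_in n p p"
    and closed: "\<And>v. v < n \<Longrightarrow> force (violated \<phi>) v p = p"
    and no_conflict: "\<not> conflict (violated \<phi>) p"
    and z: "satisfies z \<phi>"
  shows "\<exists>z'\<in>points p. satisfies z' \<phi>"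
proof -
  obtain l h where lh: "p = (l, h)" by fastforce
  \<comment> \<open>The projection keeps the fixed values of the box and takes \<open>z\<close> on
    the free variables.\<close>
  define z' where "z' v \<longleftrightarrow> l v \<or> h v \<and> z v" for v
  have le: "l v \<Longrightarrow> h v" for v using p lh by (auto simp: box_in_def le_fun_def)
  \<comment> \<open>The case \<open>b = a\<close> is allowed and covers clauses with a single
    literal.\<close>
  have false_free: False
    if C: "C \<in> set \<phi>" "C \<subseteq> {a, b}" and a: "\<not> lit_true l a" "\<not> lit_true h a"
      and b: "\<not> lit_true z' b" for C a b
  proof -
    have violates: "\<not> clause_true y C" if "\<not> lit_true y a" "\<not> lit_true y b" for y
      using C(2) that by (auto simp: clause_true_def)
    show False
    proof (cases "l (var b) = h (var b)")
      case True
      with b have "\<not> lit_true l b" "\<not> lit_true h b"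
        by (cases b; auto simp: z'_def)+
      with C a have "conflict (violated \<phi>) p"
        by (intro conflictI[OF C(1)] violates) (auto simp: lh)
      with no_conflict show False by simp
    next
      case False
      then have free: "\<not> l (var b)" "h (var b)" using le by auto
      then have "var b < n" using p lh by (auto simp: box_in_def not_le[symmetric])
      \<comment> \<open>Either conflict would make \<open>force\<close> change the box at the free
        variable \<open>var b\<close>.\<close>
      from closed[OF this] have
        nc: "\<not> conflict (violated \<phi>) (l, h(var b := False))"
          "\<not> conflict (violated \<phi>) (l(var b := True), h)"
        using free by (auto simp: force_def lh fun_upd_idem_iff split: if_splits)
      \<comment> \<open>Giving \<open>var b\<close> the value that falsifies \<open>b\<close> makes
        \<open>C\<close> false at both ends. The literal \<open>a\<close> stays false: its variable
        differs from \<open>var b\<close>, as no literal on a free variable is false at both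
        ends.\<close>
      show False
      proof (cases b)
        case (Pos w)
        have "conflict (violated \<phi>) (l, h(var b := False))"
          using a free Pos
          by (intro conflictI[OF C(1)] violates; cases a) auto
        with nc show False by simp
      next
        case (Neg w)
        have "conflict (violated \<phi>) (l(var b := True), h)"
          using a free Neg
          by (intro conflictI[OF C(1)] violates; cases a) auto
        with nc show False by simp
        qed
  qed
  qed
  have "clause_true z' C" if C: "C \<in> set \<phi>" for C
  proof (rule ccontr)
    assume false: "\<not> clause_true z' C"
    from z C obtain a where a: "a \<in> C" "lit_true z a"
      unfolding satisfies_def clause_true_def by blast
    have "finite C" "card C \<le> 2"
      using two C unfolding two_sat_instance_def sat_instance_def by auto
    then have "card (C - {a}) \<le> 1" "finite (C - {a})" using a by auto
    then obtain b where b: "C - {a} \<subseteq> {b}"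
      by (metis card_le_Suc0_iff_eq One_nat_def subsetI singletonI singletonD)
    have "\<not> lit_true z' a" using a false by (auto simp: clause_true_def)
    then have la: "\<not> lit_true l a" "\<not> lit_true h a"
      using a le by (cases a; auto simp: z'_def)+
    show False
    \<comment> \<open>If \<open>b\<close> is not in \<open>C\<close>, then \<open>a\<close> is the
      only literal of \<open>C\<close> and takes the place of \<open>b\<close>.\<close>
    proof (cases "b \<in> C")
      case True
      then show False using false_free[OF C _ la, of b] b false by (auto simp: clause_true_def)
    next
      case False
      then show False using false_free[OF C _ la, of a] b a false by (auto simp: clause_true_def)
    qed
  qed
  moreover have "z' \<in> points p" by (auto simp: lh z'_def le_fun_def le)
  ultimately show ?thesis unfolding satisfies_def by blast
qed

section \<open>Fixing the variables one after the other\<close>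

definition decide_inv :: "formula \<Rightarrow> nat \<Rightarrow> nat \<Rightarrow> box \<Rightarrow> bool" where
  "decide_inv \<phi> n i p \<longleftrightarrow> box_in n p p \<and> (\<forall>v<n. (fst p v \<longleftrightarrow> snd p v) \<longleftrightarrow> v < i) \<and>
     (satisfiable \<phi> \<longrightarrow> (\<exists>z\<in>points p. satisfies z \<phi>))"

text \<open>After a conflict, soundness of propagation shows that every solution in the box has
  variable \<open>i\<close> false. Otherwise the propagated box is closed and free of conflict, so
  some solution lies in it and hence in the box with \<open>i\<close> true.\<close>

lemma decide_inv_step:
  assumes two: "two_sat_instance n \<phi>" and inv: "decide_inv \<phi> n i p" and i: "i < n"
  shows "decide_inv \<phi> n (Suc i) (decide (violated \<phi>) n i p)"
proof -
  obtain l h where p: "p = (l, h)" by fastforce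
  have bp: "box_in n p p" using inv by (simp add: decide_inv_def)
  have free: "\<not> l i" "h i"
    using inv i p by (auto simp: decide_inv_def box_in_def le_fun_def)
  let ?t = "(l(i := True), h)"
  let ?q = "propagate (violated \<phi>) n ?t"
  let ?d = "decide (violated \<phi>) n i p"
  have bt: "box_in n ?t ?t" using bp free p by (auto simp: box_in_def le_fun_def)
  have "box_in n ?d ?d"
    using bp free p by (auto simp: decide_def box_in_def le_fun_def)
  moreover have "\<forall>v<n. (fst ?d v \<longleftrightarrow> snd ?d v) \<longleftrightarrow> v < Suc i"
    using inv free by (auto simp: decide_inv_def p decide_def less_Suc_eq)
  moreover have "\<exists>z\<in>points ?d. satisfies z \<phi>" if "satisfiable \<phi>"
  proof -
    from inv that obtain z where z: "z \<in> points p" "satisfies z \<phi>"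
      by (auto simp: decide_inv_def)
    show ?thesis
    proof (cases "conflict (violated \<phi>) ?q")
      case True
      have "\<not> z i"
      proof
        assume "z i"
        with z p have "z \<in> points ?t" by (auto simp: le_fun_def)
        from conflict_sound[OF True propagate_sound[OF z(2) this]] z(2) show False by simp
      qed
      with z p True show ?thesis by (auto simp: decide_def le_fun_def intro!: bexI[of _ z])
    next
      case False
      have bq: "box_in n ?t ?q" by (rule propagate_box_in[OF bt])
      from closed_extends[OF two box_in_refl[OF bq] propagate_closed[OF bt] False z(2)]
      obtain z' where z': "z' \<in> points ?q" "satisfies z' \<phi>" by blast
      have "points ?q \<subseteq> points ?t"
        using bq by (auto simp: box_in_def intro: order_trans)
      with z'(1) have "z' \<in> points ?d" using False by (auto simp: decide_def p)
      with z'(2) show ?thesis by blast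
    qed
  qed
  ultimately show ?thesis unfolding decide_inv_def by blast
qed

lemma satisfies_cong:
  assumes "sat_instance n \<phi>" "\<And>v. v < n \<Longrightarrow> y v = z v"
  shows "satisfies y \<phi> \<longleftrightarrow> satisfies z \<phi>"
proof -
  have "lit_true y l \<longleftrightarrow> lit_true z l" if "C \<in> set \<phi>" "l \<in> C" for C l
  proof -
    have "var l < n" using assms(1) that unfolding sat_instance_def by blast
    then show ?thesis using assms(2) by (cases l) auto
  qed
  then show ?thesis unfolding satisfies_def clause_true_def by blast
qed

definition decide_all :: "clause_oracle \<Rightarrow> nat \<Rightarrow> box" where
  "decide_all \<O> n = fold (decide \<O> n) [0..<n] (\<lambda>_. False, \<lambda>v. v < n)"

lemma decide_all_inv:
  assumes two: "two_sat_instance n \<phi>"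
  shows "decide_inv \<phi> n n (decide_all (violated \<phi>) n)"
proof -
  let ?p = "\<lambda>i. fold (decide (violated \<phi>) n) [0..<i] (\<lambda>_. False, \<lambda>v. v < n)"
  have "decide_inv \<phi> n i (?p i)" if "i \<le> n" for i
    using that
  proof (induction i)
    case 0
    \<comment> \<open>The initial box is false from \<open>n\<close> on, so a solution has to be
      truncated to lie in it.\<close>
    have "satisfies (\<lambda>v. v < n \<and> z v) \<phi>" if "satisfies z \<phi>" for z
      using two that
      by (subst satisfies_cong[where z = z and n = n]) (auto simp: two_sat_instance_def)
    then show ?case
      by (fastforce simp: decide_inv_def box_in_def le_fun_def satisfiable_def)
  next
    case (Suc i)
    then show ?case using decide_inv_step[OF two, of i "?p i"] by simp
  qed
  from this[of n] show ?thesis by (simp add: decide_all_def)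
qed

text \<open>Below \<open>n\<close> the invariant fixes every variable; from \<open>n\<close> on both
  ends are false. The final box is a single point, the only candidate left.\<close>

lemma decide_all_total:
  assumes "two_sat_instance n \<phi>"
  shows "snd (decide_all (violated \<phi>) n) = fst (decide_all (violated \<phi>) n)"
proof
  fix v
  show "snd (decide_all (violated \<phi>) n) v = fst (decide_all (violated \<phi>) n) v"
    using decide_all_inv[OF assms]
    by (cases "v < n") (auto simp: decide_inv_def box_in_def le_fun_def)
qed

lemma decide_all_satisfies:
  assumes "two_sat_instance n \<phi>" "satisfiable \<phi>"
  shows "satisfies (fst (decide_all (violated \<phi>) n)) \<phi>"
  using assms decide_all_inv[OF assms(1)] decide_all_total[OF assms(1)]
  by (auto simp: decide_inv_def dest: order_antisym)

section \<open>Weakest preconditions with running time\<close>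

text \<open>Total correctness: termination is included, and the postcondition also receives the
  running time, so results and time bounds are proved together.\<close>

definition wp :: "clause_oracle \<Rightarrow> com \<Rightarrow> state \<Rightarrow> (nat \<Rightarrow> state \<Rightarrow> bool) \<Rightarrow> bool" where
  "wp \<O> c s Q \<longleftrightarrow> (\<exists>t s'. exec \<O> c s t s' \<and> Q t s')"

lemma wp_mono: "wp \<O> c s Q \<Longrightarrow> (\<And>t s'. Q t s' \<Longrightarrow> R t s') \<Longrightarrow> wp \<O> c s R"
  unfolding wp_def by blast

lemma wp_Skip: "wp \<O> Skip s Q \<longleftrightarrow> Q 1 s"
  unfolding wp_def by (auto elim: exec_elims intro: exec.Skip[unfolded One_nat_def])

lemma wp_Assign: "wp \<O> (Assign r e) s Q \<longleftrightarrow> Q (1 + cost e) (s\<lparr>reg := (reg s)(r := val e s)\<rparr>)"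
  unfolding wp_def by (metis exec.Assign exec_deterministic)

lemma wp_Store: "wp \<O> (Store a i e) s Q \<longleftrightarrow>
    Q (1 + cost i + cost e) (s\<lparr>arr := (arr s)(a := (arr s a)(val i s := val e s))\<rparr>)"
  unfolding wp_def by (metis exec.Store exec_deterministic)

lemma wp_Query: "wp \<O> (Query a b) s Q \<longleftrightarrow>
    Q 1 (s\<lparr>arr := (arr s)(b := (\<lambda>j. of_bool (j \<in> \<O> (\<lambda>i. arr s a i \<noteq> 0))))\<rparr>)"
  unfolding wp_def of_bool_def by (metis exec.Query exec_deterministic)

lemma wp_Seq: "wp \<O> (Seq c d) s Q \<longleftrightarrow> wp \<O> c s (\<lambda>t s'. wp \<O> d s' (\<lambda>u. Q (t + u)))"
  unfolding wp_def by (blast elim: exec_elims intro: exec.Seq)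

lemma wp_Cond: "wp \<O> (Cond e c d) s Q \<longleftrightarrow>
    wp \<O> (if val e s \<noteq> 0 then c else d) s (\<lambda>t. Q (1 + cost e + t))"
proof -
  have "exec \<O> (Cond e c d) s t s' \<longleftrightarrow>
      (\<exists>u. t = 1 + cost e + u \<and> exec \<O> (if val e s \<noteq> 0 then c else d) s u s')" for t s'
    by (auto elim: exec_elims intro: exec.CondTrue[simplified] exec.CondFalse[simplified])
  then show ?thesis unfolding wp_def by auto
qed

lemma wp_WhileTrue:
  "val e s \<noteq> 0 \<Longrightarrow> wp \<O> c s (\<lambda>t s'. wp \<O> (While e c) s' (\<lambda>u. Q (1 + cost e + t + u))) \<Longrightarrow>
   wp \<O> (While e c) s Q"
  unfolding wp_def by (blast intro: exec.WhileTrue)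

lemma wp_WhileFalse: "val e s = 0 \<Longrightarrow> Q (1 + cost e) s \<Longrightarrow> wp \<O> (While e c) s Q"
  unfolding wp_def by (blast intro: exec.WhileFalse)

lemmas wp_simps = wp_Skip wp_Assign wp_Store wp_Query wp_Seq wp_Cond

text \<open>Truncated subtraction serves as the comparison: the loop test is nonzero exactly while
  \<open>r\<close> is below \<open>b\<close>.\<close>

definition For :: "string \<Rightarrow> string \<Rightarrow> com \<Rightarrow> com" where
  "For r b c = Seq (Assign r (Num 0))
     (While (Sub (Reg b) (Reg r)) (Seq c (Assign r (Add (Reg r) (Num 1)))))"

text \<open>Each round pays \<open>T\<close> for the body, 4 for the test and 4 for the increment.
  The initial assignment costs 2 and the failing test 4. The induction is on the number
  \<open>d\<close> of rounds left.\<close>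

lemma wp_For:
  assumes init: "I 0 (s\<lparr>reg := (reg s)(r := 0)\<rparr>)"
    and regs: "\<And>j s. I j s \<Longrightarrow> reg s r = j \<and> reg s b = N"
    and body: "\<And>j s. j < N \<Longrightarrow> I j s \<Longrightarrow>
      wp \<O> c s (\<lambda>t s'. t \<le> T \<and> reg s' r = j \<and> I (Suc j) (s'\<lparr>reg := (reg s')(r := Suc j)\<rparr>))"
  shows "wp \<O> (For r b c) s (\<lambda>t s'. t \<le> N * (T + 8) + 6 \<and> I N s')"
proof -
  let ?W = "While (Sub (Reg b) (Reg r)) (Seq c (Assign r (Add (Reg r) (Num 1))))"
  have loop: "wp \<O> ?W s (\<lambda>t s'. t \<le> d * (T + 8) + 4 \<and> I N s')" if "I j s" "j + d = N" for j d s
    using that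
  proof (induction d arbitrary: j s)
    case 0
    then show ?case using regs[OF 0(1)] by (intro wp_WhileFalse) auto
  next
    case (Suc d)
    from Suc.prems have j: "j < N" by simp
    show ?case
    proof (rule wp_WhileTrue)
      show "val (Sub (Reg b) (Reg r)) s \<noteq> 0" using regs[OF Suc.prems(1)] j by simp
      show "wp \<O> (Seq c (Assign r (Add (Reg r) (Num 1)))) s (\<lambda>t s'. wp \<O> ?W s'
          (\<lambda>u s'. 1 + cost (Sub (Reg b) (Reg r)) + t + u \<le> Suc d * (T + 8) + 4 \<and> I N s'))"
        unfolding wp_Seq wp_Assign
      proof (rule wp_mono[OF body[OF j Suc.prems(1)]], elim conjE)
        fix t s'
        assume t: "t \<le> T" and r: "reg s' r = j"
          and inv: "I (Suc j) (s'\<lparr>reg := (reg s')(r := Suc j)\<rparr>)"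
        have "Suc j + d = N" using Suc.prems by simp
        from Suc.IH[OF inv this]
        have "wp \<O> ?W (s'\<lparr>reg := (reg s')(r := val (Add (Reg r) (Num 1)) s')\<rparr>)
          (\<lambda>t s'. t \<le> d * (T + 8) + 4 \<and> I N s')" using r by simp
        then show "wp \<O> ?W (s'\<lparr>reg := (reg s')(r := val (Add (Reg r) (Num 1)) s')\<rparr>)
          (\<lambda>u s'. 1 + cost (Sub (Reg b) (Reg r)) + (t + (1 + cost (Add (Reg r) (Num 1)))) + u
             \<le> Suc d * (T + 8) + 4 \<and> I N s')"
          by (rule wp_mono) (use t in auto)
      qed
    qed
  qed
  show ?thesis
    unfolding For_def wp_Seq wp_Assign
    using loop[OF init, of N] by (auto elim: wp_mono)
qed

section \<open>The program\<close>

text \<open>The answers are stored as 0/1 arrays, so the truncated sum minus 1 is nonzero exactly if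
  an index occurs in both.\<close>

definition test_com :: com where
  "test_com = Seq (Query ''lo'' ''a'') (Seq (Query ''hi'' ''b'') (Seq (Assign ''f'' (Num 0))
     (For ''j'' ''m'' (Cond (Sub (Add (Elem ''a'' (Reg ''j'')) (Elem ''b'' (Reg ''j''))) (Num 1))
        (Assign ''f'' (Num 1)) Skip))))"

text \<open>After the first test, \<open>lo\<close> and \<open>hi\<close> are set to the box with
  \<open>v\<close> true. This is the result if that test found a conflict, and otherwise the box for
  the second test.\<close>

definition force_com :: com where
  "force_com = Cond (Sub (Elem ''hi'' (Reg ''v'')) (Elem ''lo'' (Reg ''v'')))
     (Seq (Store ''hi'' (Reg ''v'') (Num 0)) (Seq test_com
     (Seq (Store ''hi'' (Reg ''v'') (Num 1)) (Seq (Store ''lo'' (Reg ''v'') (Num 1))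
     (Cond (Reg ''f'') Skip
       (Seq test_com (Seq (Store ''lo'' (Reg ''v'') (Num 0))
         (Cond (Reg ''f'') (Store ''hi'' (Reg ''v'') (Num 0)) Skip))))))))
     Skip"

definition copy_com :: com where
  "copy_com = For ''v'' ''n''
     (Seq (Store ''lo'' (Reg ''v'') (Elem ''x'' (Reg ''v'')))
          (Store ''hi'' (Reg ''v'') (Elem ''y'' (Reg ''v''))))"

definition propagate_com :: com where
  "propagate_com = For ''k'' ''n'' (For ''v'' ''n'' force_com)"

definition decide_com :: com where
  "decide_com = Seq copy_com (Seq (Store ''lo'' (Reg ''i'') (Num 1)) (Seq propagate_com
     (Seq test_com (Cond (Reg ''f'')
       (Store ''y'' (Reg ''i'') (Num 0)) (Store ''x'' (Reg ''i'') (Num 1))))))"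

text \<open>Arrays start at zero, so only \<open>y\<close> needs filling. For a 2SAT instance both
  ends of the final box coincide, and the last conflict test becomes a test for
  satisfaction.\<close>

definition two_sat_com :: com where
  "two_sat_com = Seq (For ''v'' ''n'' (Store ''y'' (Reg ''v'') (Num 1)))
     (Seq (For ''i'' ''n'' decide_com)
     (Seq copy_com (Seq test_com (Assign ''sat'' (Sub (Num 1) (Reg ''f''))))))"

text \<open>The box \<open>p\<close> of decided variables is kept in \<open>x\<close> and \<open>y\<close>, the box \<open>q\<close> being propagated in
  \<open>lo\<close> and \<open>hi\<close>.\<close>

definition stores :: "nat \<Rightarrow> nat \<Rightarrow> nat \<Rightarrow> nat \<Rightarrow> nat \<Rightarrow> box \<Rightarrow> box \<Rightarrow> state \<Rightarrow> bool" where
  "stores n m i k v p q s \<longleftrightarrow>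
     reg s ''n'' = n \<and> reg s ''m'' = m \<and> reg s ''i'' = i \<and> reg s ''k'' = k \<and> reg s ''v'' = v \<and>
     (\<forall>u. arr s ''x'' u = of_bool (fst p u)) \<and> (\<forall>u. arr s ''y'' u = of_bool (snd p u)) \<and>
     (\<forall>u. arr s ''lo'' u = of_bool (fst q u)) \<and> (\<forall>u. arr s ''hi'' u = of_bool (snd q u))"

text \<open>Copying touches only the entries below \<open>n\<close>; it copies the whole box because
  source and target are both false beyond.\<close>

definition bounded :: "nat \<Rightarrow> box \<Rightarrow> bool" where
  "bounded n p \<longleftrightarrow> (\<forall>v\<ge>n. \<not> fst p v \<and> \<not> snd p v)"

lemma bounded_fold_force: "bounded n p \<Longrightarrow> j \<le> n \<Longrightarrow> bounded n (fold (force \<O>) [0..<j] p)"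
  by (induction j) (auto simp: bounded_def force_def split: prod.splits)

lemma bounded_propagate: "bounded n p \<Longrightarrow> bounded n (propagate \<O> n p)"
proof -
  assume "bounded n p"
  then have "bounded n ((fold (force \<O>) [0..<n] ^^ k) p)" for k
    by (induction k) (auto intro: bounded_fold_force)
  then show ?thesis unfolding propagate_def .
qed

lemma bounded_decide: "bounded n p \<Longrightarrow> i < n \<Longrightarrow> bounded n (decide \<O> n i p)"
  by (auto simp: bounded_def decide_def split: prod.splits)

section \<open>Correctness and running time of the program fragments\<close>

lemma wp_test:
  assumes range: "\<And>x. \<O> x \<subseteq> {..<m}" and s: "stores n m i k v p q s"
  shows "wp \<O> test_com s (\<lambda>t s'. t \<le> 19 * m + 10 \<and> stores n m i k v p q s' \<and>
    reg s' ''f'' = of_bool (conflict \<O> q))"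
proof -
  define I where "I j s \<longleftrightarrow> stores n m i k v p q s \<and> reg s ''j'' = j \<and>
    (\<forall>u. arr s ''a'' u = of_bool (u \<in> \<O> (fst q))) \<and>
    (\<forall>u. arr s ''b'' u = of_bool (u \<in> \<O> (snd q))) \<and>
    reg s ''f'' = of_bool (\<exists>u<j. u \<in> \<O> (fst q) \<and> u \<in> \<O> (snd q))" for j and s :: state
  let ?body = "Cond (Sub (Add (Elem ''a'' (Reg ''j'')) (Elem ''b'' (Reg ''j''))) (Num 1))
        (Assign ''f'' (Num 1)) Skip"
  \<comment> \<open>The condition costs 8 and a branch at most 2, within the 11 allowed per
    round.\<close>
  have loop: "wp \<O> (For ''j'' ''m'' ?body) s (\<lambda>t s'. t \<le> m * (11 + 8) + 6 \<and> I m s')"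
    if "I 0 (s\<lparr>reg := (reg s)(''j'' := 0)\<rparr>)" for s
    using that
    by (rule wp_For) (auto simp: I_def stores_def wp_simps less_Suc_eq)
  \<comment> \<open>Answers contain only indices below \<open>m\<close>, so the scan misses no
    conflict.\<close>
  have "(\<exists>u<m. u \<in> \<O> (fst q) \<and> u \<in> \<O> (snd q)) \<longleftrightarrow> conflict \<O> q"
    using range unfolding conflict_def by blast
  moreover have "wp \<O> test_com s (\<lambda>t s'. t \<le> 19 * m + 10 \<and> I m s')"
    unfolding test_com_def wp_simps
    by (rule wp_mono[OF loop]) (use s in \<open>auto simp: I_def stores_def\<close>)
  ultimately show ?thesis
    by (auto simp: I_def elim!: wp_mono)
qed

text \<open>Two tests cost at most \<open>38 * m + 20\<close>; the conditions and stores on the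
  longest path add 25.\<close>

lemma wp_force:
  assumes range: "\<And>x. \<O> x \<subseteq> {..<m}" and s: "stores n m i k v p q s"
  shows "wp \<O> force_com s (\<lambda>t s'. t \<le> 38 * m + 45 \<and> stores n m i k v p (force \<O> v q) s')"
proof -
  obtain l h where q: "q = (l, h)" by fastforce
  show ?thesis
  proof (cases "\<not> l v \<and> h v")
    case False
    then show ?thesis
      using s by (auto simp: force_com_def wp_simps stores_def force_def q)
  next
    case True
    then have cond: "val (Sub (Elem ''hi'' (Reg ''v'')) (Elem ''lo'' (Reg ''v''))) s \<noteq> 0"
      using s by (simp add: stores_def q)
    show ?thesis
      unfolding force_com_def wp_Cond if_P[OF cond]
    proof (simp add: wp_simps, rule wp_mono[OF wp_test[OF range,
          where q = "(l, h(v := False))" and n = n and i = i and k = k and v = v and p = p]],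
        goal_cases)
      case 1
      show ?case using s by (auto simp: stores_def q)
    next
      case (2 t s')
      show ?case
      proof (cases "conflict \<O> (l, h(v := False))")
        case conflict: True
        then show ?thesis using 2 True by (auto simp: wp_simps stores_def force_def q)
      next
        case no_conflict: False
        then have f: "reg s' ''f'' = 0" using 2 by simp
        show ?thesis
        proof (simp add: f wp_simps, rule wp_mono[OF wp_test[OF range,
              where q = "(l(v := True), h)" and n = n and i = i and k = k and v = v and p = p]],
            goal_cases)
          case 1
          show ?case using 2 True by (auto simp: stores_def)
        next
          case 3: (2 u s'')
          show ?case using 2 3 True no_conflict
            by (auto simp: wp_simps stores_def force_def q)
        qed
      qed
    qed
  qed
qed

lemma wp_copy:
  assumes s: "stores n m i k v p q s" and b: "bounded n p" "bounded n q"
  shows "wp \<O> copy_com s (\<lambda>t s'. t \<le> 16 * n + 6 \<and> stores n m i k n p p s')"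
proof -
  \<comment> \<open>Entries below \<open>j\<close> are already copied from \<open>p\<close>, the
    others still stem from \<open>q\<close>.\<close>
  define I where "I j = stores n m i k j p
    (\<lambda>u. if u < j then fst p u else fst q u, \<lambda>u. if u < j then snd p u else snd q u)" for j
  have "wp \<O> copy_com s (\<lambda>t s'. t \<le> n * (8 + 8) + 6 \<and> I n s')"
    unfolding copy_com_def
    by (rule wp_For) (use s in \<open>auto simp: I_def stores_def wp_simps less_Suc_eq\<close>)
  then show ?thesis
  proof (rule wp_mono, elim conjE)
    fix t s'
    assume t: "t \<le> n * (8 + 8) + 6" and "I n s'"
    then have "stores n m i k n p p s'"
      using b unfolding I_def stores_def bounded_def by (auto simp: not_less)
    with t show "t \<le> 16 * n + 6 \<and> stores n m i k n p p s'" by simp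
  qed
qed

lemma wp_propagate:
  assumes range: "\<And>x. \<O> x \<subseteq> {..<m}" and s: "stores n m i k v p q s"
  shows "wp \<O> propagate_com s (\<lambda>t s'. t \<le> n * (n * (38 * m + 53) + 14) + 6 \<and>
    (\<exists>v'. stores n m i n v' p (propagate \<O> n q) s'))"
proof -
  \<comment> \<open>Register \<open>v\<close> holds its old value before the first sweep and
    \<open>n\<close> afterwards, hence the existential.\<close>
  define I where "I j s \<longleftrightarrow> (\<exists>v. stores n m i j v p ((fold (force \<O>) [0..<n] ^^ j) q) s)"
    for j and s :: state
  have inner: "wp \<O> (For ''v'' ''n'' force_com) s
      (\<lambda>t s'. t \<le> n * (38 * m + 45 + 8) + 6 \<and> stores n m i j n p (fold (force \<O>) [0..<n] r) s')"
    if "stores n m i j v p r s" for j v r s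
  proof (rule wp_For[where I = "\<lambda>w. stores n m i j w p (fold (force \<O>) [0..<w] r)"])
    show "stores n m i j 0 p (fold (force \<O>) [0..<0] r) (s\<lparr>reg := (reg s)(''v'' := 0)\<rparr>)"
      using that by (auto simp: stores_def)
  next
    fix w and s :: state
    assume "stores n m i j w p (fold (force \<O>) [0..<w] r) s"
    from wp_force[OF range this]
    show "wp \<O> force_com s (\<lambda>t s'. t \<le> 38 * m + 45 \<and> reg s' ''v'' = w \<and>
      stores n m i j (Suc w) p (fold (force \<O>) [0..<Suc w] r)
        (s'\<lparr>reg := (reg s')(''v'' := Suc w)\<rparr>))"
      by (rule wp_mono) (auto simp: stores_def)
  qed (auto simp: stores_def)
  have "wp \<O> propagate_com s (\<lambda>t s'. t \<le> n * (n * (38 * m + 45 + 8) + 6 + 8) + 6 \<and> I n s')"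
    unfolding propagate_com_def
  proof (rule wp_For)
    show "I 0 (s\<lparr>reg := (reg s)(''k'' := 0)\<rparr>)"
      using s by (auto simp: I_def stores_def)
  next
    fix j and s :: state
    assume "I j s"
    then obtain v where "stores n m i j v p ((fold (force \<O>) [0..<n] ^^ j) q) s"
      by (auto simp: I_def)
    from inner[OF this]
    show "wp \<O> (For ''v'' ''n'' force_com) s (\<lambda>t s'. t \<le> n * (38 * m + 45 + 8) + 6 \<and>
      reg s' ''k'' = j \<and> I (Suc j) (s'\<lparr>reg := (reg s')(''k'' := Suc j)\<rparr>))"
      by (rule wp_mono) (auto simp: I_def stores_def)
  qed (auto simp: I_def stores_def)
  then show ?thesis
    by (rule wp_mono) (simp add: I_def propagate_def algebra_simps)
qed

lemma wp_decide:
  assumes range: "\<And>x. \<O> x \<subseteq> {..<m}" and s: "stores n m i k v p q s"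
    and b: "bounded n p" "bounded n q" and i: "i < n"
  shows "wp \<O> decide_com s (\<lambda>t s'. t \<le> n * (n * (38 * m + 53) + 30) + 19 * m + 30 \<and>
    (\<exists>k v q. stores n m i k v (decide \<O> n i p) q s' \<and> bounded n q))"
proof -
  obtain l h where p: "p = (l, h)" by fastforce
  let ?q = "propagate \<O> n (l(i := True), h)"
  \<comment> \<open>The propagated box is left in \<open>lo\<close> and \<open>hi\<close>, where the
    next copy overwrites it.\<close>
  have bq: "bounded n ?q"
    using b(1) i by (intro bounded_propagate) (auto simp: bounded_def p)
  show ?thesis
    unfolding decide_com_def
  proof (simp only: wp_simps, rule wp_mono[OF wp_copy[OF s b]], elim conjE)
    fix t1 s1
    assume t1: "t1 \<le> 16 * n + 6" and s1: "stores n m i k n p p s1"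
    show "wp \<O> propagate_com
      (s1\<lparr>arr := (arr s1)(''lo'' := (arr s1 ''lo'')(val (Reg ''i'') s1 := val (Num 1) s1))\<rparr>)
      (\<lambda>t2 s2. wp \<O> test_com s2 (\<lambda>t3 s3. wp \<O>
        (if val (Reg ''f'') s3 \<noteq> 0 then Store ''y'' (Reg ''i'') (Num 0)
         else Store ''x'' (Reg ''i'') (Num 1)) s3
        (\<lambda>t4 s4. t1 + (1 + cost (Reg ''i'') + cost (Num 1) + (t2 + (t3 + (1 + cost (Reg ''f'') + t4))))
            \<le> n * (n * (38 * m + 53) + 30) + 19 * m + 30 \<and>
          (\<exists>k v q. stores n m i k v (decide \<O> n i p) q s4 \<and> bounded n q))))"
    proof (rule wp_mono[OF wp_propagate[OF range,
          where q = "(l(i := True), h)" and n = n and i = i and k = k and v = n and p = p]],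
        goal_cases)
      case 1
      show ?case using s1 by (auto simp: stores_def p)
    next
      case (2 t2 s2)
      then obtain v where t2: "t2 \<le> n * (n * (38 * m + 53) + 14) + 6"
        and s2: "stores n m i n v p ?q s2" by blast
      show ?case
      proof (rule wp_mono[OF wp_test[OF range s2]], elim conjE)
        fix t3 s3
        assume t3: "t3 \<le> 19 * m + 10" and s3: "stores n m i n v p ?q s3"
          and f: "reg s3 ''f'' = of_bool (conflict \<O> ?q)"
        \<comment> \<open>The 8 units are 3 for setting \<open>lo\<close>, 2 for the condition and 3
          for the final store.\<close>
        have "t1 + (t2 + t3) + 8 \<le> n * (n * (38 * m + 53) + 30) + 19 * m + 30"
          using t1 t2 t3 by (simp add: algebra_simps)
        moreover have "\<exists>k v q. stores n m i k v (decide \<O> n i p) q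
          (if conflict \<O> ?q then s3\<lparr>arr := (arr s3)(''y'' := (arr s3 ''y'')(i := 0))\<rparr>
           else s3\<lparr>arr := (arr s3)(''x'' := (arr s3 ''x'')(i := 1))\<rparr>) \<and> bounded n q"
          using s3 bq by (intro exI[of _ n] exI[of _ v] exI[of _ ?q])
            (auto simp: stores_def decide_def p)
        moreover have "reg s3 ''i'' = i" using s3 by (simp add: stores_def)
        ultimately show "wp \<O>
        (if val (Reg ''f'') s3 \<noteq> 0 then Store ''y'' (Reg ''i'') (Num 0)
         else Store ''x'' (Reg ''i'') (Num 1)) s3
        (\<lambda>t4 s4. t1 + (1 + cost (Reg ''i'') + cost (Num 1) + (t2 + (t3 + (1 + cost (Reg ''f'') + t4))))
            \<le> n * (n * (38 * m + 53) + 30) + 19 * m + 30 \<and>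
          (\<exists>k v q. stores n m i k v (decide \<O> n i p) q s4 \<and> bounded n q))"
          using f by (simp add: wp_simps del: split_paired_Ex split: if_splits)
      qed
    qed
  qed
qed

text \<open>This links the program to \<open>decide_all\<close> for any oracle answering with
  indices below \<open>m\<close>; the meaning for formulas comes from the earlier invariant.\<close>

lemma wp_two_sat:
  assumes range: "\<And>x. \<O> x \<subseteq> {..<m}"
  shows "wp \<O> two_sat_com (initial n m) (\<lambda>t s.
    t \<le> n * (n * (n * (38 * m + 53) + 30) + 19 * m + 38) + 27 * n + 19 * m + 32 \<and>
    arr s ''x'' = (\<lambda>u. of_bool (fst (decide_all \<O> n) u)) \<and>
    reg s ''sat'' = of_bool (\<not> conflict \<O> (decide_all \<O> n)))"
proof -
  let ?p = "\<lambda>i. fold (decide \<O> n) [0..<i] (\<lambda>_. False, \<lambda>v. v < n)"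
  have bp: "bounded n (?p i)" if "i \<le> n" for i
    using that
  proof (induction i)
    case (Suc i)
    then show ?case using bounded_decide[of n "?p i" i \<O>] by simp
  qed (simp add: bounded_def)
  define B where "B j = stores n m 0 0 j (\<lambda>_. False, \<lambda>v. v < j) (\<lambda>_. False, \<lambda>_. False)" for j
  have init: "wp \<O> (For ''v'' ''n'' (Store ''y'' (Reg ''v'') (Num 1))) (initial n m)
    (\<lambda>t s. t \<le> n * (3 + 8) + 6 \<and> B n s)"
    by (rule wp_For) (auto simp: B_def stores_def initial_def wp_simps less_Suc_eq)
  define I where "I i s \<longleftrightarrow> (\<exists>k v q. stores n m i k v (?p i) q s \<and> bounded n q)"
    for i and s :: state
  let ?D = "n * (n * (38 * m + 53) + 30) + 19 * m + 30"
  have main: "wp \<O> (For ''i'' ''n'' decide_com) s (\<lambda>t s. t \<le> n * (?D + 8) + 6 \<and> I n s)"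
    if "B n s" for s
  proof (rule wp_For)
    show "I 0 (s\<lparr>reg := (reg s)(''i'' := 0)\<rparr>)"
      using that unfolding I_def B_def
      by (intro exI[of _ 0] exI[of _ n] exI[of _ "(\<lambda>_. False, \<lambda>_. False)"])
        (auto simp: stores_def bounded_def)
  next
    fix i and s :: state
    assume i: "i < n" and "I i s"
    then obtain k v q where "stores n m i k v (?p i) q s" "bounded n q"
      by (auto simp: I_def)
    from wp_decide[OF range this(1) bp this(2) i] i
    have "wp \<O> decide_com s (\<lambda>t s'. t \<le> ?D \<and>
        (\<exists>k v q. stores n m i k v (?p (Suc i)) q s' \<and> bounded n q))" by simp
    then show "wp \<O> decide_com s (\<lambda>t s'. t \<le> ?D \<and> reg s' ''i'' = i \<and>
        I (Suc i) (s'\<lparr>reg := (reg s')(''i'' := Suc i)\<rparr>))"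
    proof (rule wp_mono, elim conjE exE)
      fix t s' k v q
      assume t: "t \<le> ?D" and s': "stores n m i k v (?p (Suc i)) q s'" and q: "bounded n q"
      from s' have "reg s' ''i'' = i" by (simp add: stores_def)
      moreover from s' have
        "stores n m (Suc i) k v (?p (Suc i)) q (s'\<lparr>reg := (reg s')(''i'' := Suc i)\<rparr>)"
        by (simp add: stores_def)
      ultimately show "t \<le> ?D \<and> reg s' ''i'' = i \<and>
          I (Suc i) (s'\<lparr>reg := (reg s')(''i'' := Suc i)\<rparr>)"
        using t q unfolding I_def by blast
    qed
  qed (auto simp: I_def stores_def)
  show ?thesis
    unfolding two_sat_com_def wp_Seq
  proof (rule wp_mono[OF init], elim conjE, rule wp_mono[OF main], assumption, elim conjE)
    fix t1 t2 s2
    assume t1: "t1 \<le> n * (3 + 8) + 6" and t2: "t2 \<le> n * (?D + 8) + 6" and "I n s2"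
    then obtain k v q where s2: "stores n m n k v (decide_all \<O> n) q s2" "bounded n q"
      by (auto simp: I_def decide_all_def)
    have b: "bounded n (decide_all \<O> n)" using bp[of n] by (simp add: decide_all_def)
    show "wp \<O> copy_com s2 (\<lambda>t3 s3. wp \<O> test_com s3 (\<lambda>t4 s4.
      wp \<O> (Assign ''sat'' (Sub (Num 1) (Reg ''f''))) s4 (\<lambda>t5 s.
        t1 + (t2 + (t3 + (t4 + t5)))
          \<le> n * (n * (n * (38 * m + 53) + 30) + 19 * m + 38) + 27 * n + 19 * m + 32 \<and>
        arr s ''x'' = (\<lambda>u. of_bool (fst (decide_all \<O> n) u)) \<and>
        reg s ''sat'' = of_bool (\<not> conflict \<O> (decide_all \<O> n)))))"
    proof (rule wp_mono[OF wp_copy[OF s2(1) b s2(2)]], elim conjE,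
        rule wp_mono[OF wp_test[OF range]], assumption, elim conjE)
      fix t3 t4 s4
      assume "t3 \<le> 16 * n + 6" "t4 \<le> 19 * m + 10"
        "stores n m n k n (decide_all \<O> n) (decide_all \<O> n) s4"
        "reg s4 ''f'' = of_bool (conflict \<O> (decide_all \<O> n))"
      then show "wp \<O> (Assign ''sat'' (Sub (Num 1) (Reg ''f''))) s4 (\<lambda>t5 s.
        t1 + (t2 + (t3 + (t4 + t5)))
          \<le> n * (n * (n * (38 * m + 53) + 30) + 19 * m + 38) + 27 * n + 19 * m + 32 \<and>
        arr s ''x'' = (\<lambda>u. of_bool (fst (decide_all \<O> n) u)) \<and>
        reg s ''sat'' = of_bool (\<not> conflict \<O> (decide_all \<O> n)))"
        using t1 t2 by (auto simp: wp_simps stores_def algebra_simps)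
    qed
  qed
qed

section \<open>From the final single-point box to the answer\<close>

lemma conflict_iff_violated:
  "conflict (violated \<phi>) (z, z) \<longleftrightarrow> \<not> satisfies z \<phi>"
  by (auto simp: conflict_def violated_def satisfies_def all_set_conv_all_nth)

theorem corollary1:
  "\<exists>(c :: com) (p :: nat poly poly). \<forall>(n :: nat) (m :: nat) (\<phi> :: formula).
     two_sat_instance n \<phi> \<and> length \<phi> = m \<longrightarrow>
     (\<exists>t s. exec (violated \<phi>) c (initial n m) t s \<and> t \<le> poly2 p n m \<and> correct_output \<phi> s)"
proof (rule exI, rule exI, intro allI impI, elim conjE)
  fix n m :: nat and \<phi> :: formula
  \<comment> \<open>\<open>?N\<close> is the outer indeterminate, evaluated first at
    \<open>[:n:]\<close>; \<open>?M\<close> is the inner one as a constant, evaluated at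
    \<open>m\<close>. Program and polynomial remain schematic until the last \<open>show\<close> and
    cannot depend on the instance.\<close>
  let ?N = "[:0, 1:] :: nat poly poly" and ?M = "[:[:0, 1:]:] :: nat poly poly"
  let ?P = "?N * (?N * (?N * (38 * ?M + 53) + 30) + 19 * ?M + 38) + 27 * ?N + 19 * ?M + 32"
  assume two: "two_sat_instance n \<phi>" and m: "length \<phi> = m"
  define p where "p = decide_all (violated \<phi>) n"
  have p: "p = (fst p, fst p)"
    using decide_all_total[OF two] by (simp add: p_def prod_eq_iff)
  have range: "violated \<phi> x \<subseteq> {..<m}" for x
    using m by (auto simp: violated_def)
  have bound: "poly2 ?P n m
      = n * (n * (n * (38 * m + 53) + 30) + 19 * m + 38) + 27 * n + 19 * m + 32"
    by (simp add: poly2_def algebra_simps)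
  have sat: "satisfiable \<phi> \<longleftrightarrow> satisfies (fst p) \<phi>"
    using decide_all_satisfies[OF two] by (auto simp: p_def satisfiable_def)
  have conflict: "conflict (violated \<phi>) p \<longleftrightarrow> \<not> satisfies (fst p) \<phi>"
    by (subst p) (rule conflict_iff_violated)
  from wp_two_sat[where \<O> = "violated \<phi>" and n = n, OF range]
  obtain t s where "exec (violated \<phi>) two_sat_com (initial n m) t s" "t \<le> poly2 ?P n m"
    and x: "arr s ''x'' = (\<lambda>u. of_bool (fst p u))"
    and s: "reg s ''sat'' = of_bool (\<not> conflict (violated \<phi>) p)"
    unfolding bound wp_def p_def by blast
  moreover have "correct_output \<phi> s"
    unfolding correct_output_def sat using x s conflict by simp
  ultimately show "\<exists>t s. exec (violated \<phi>) two_sat_com (initial n m) t s \<and>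
      t \<le> poly2 ?P n m \<and> correct_output \<phi> s"
    by blast
qed

end
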